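(* Let $\mathbf v_1,\dots,\mathbf v_n$ be $n$ invertible elements of $K^n$ (i.e. vectors with all entries non-zero), with $\mathbf v_1=(1,\dots,1)$, such that $\det\begin{pmatrix}\mathbf v_1^{T}&\dots&\mathbf v_n^{T}\end{pmatrix}=1$. There exists a unique twisting map $\xi\colon K^n\otimes K^n\longrightarrow K^n\otimes K^n$ with $$A_\xi(i,l)=(-1)^{i-1}\,(\mathbf v_l^{\bullet}\bullet\mathbf v_i)^{T}\,\bigl(\mathbf v_l\bullet(\mathbf v_1\times\cdots\times\widehat{\mathbf v_i}\times\cdots\times\mathbf v_n)\bigr)\qquad\text{for all } i,l\in\{1,\dots,n\},$$ where $\widehat{\mathbf v_i}$ means that the term $\mathbf v_i$ is omitted. Moreover, the twisted tensor product algebra $K^n\otimes_\xi K^n$ is isomorphic to $M_n(K)$.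
   Context: $K$ is a field. Elements of $K^n$ are row vectors; $\bullet$ denotes the entrywise multiplication of $K^n$, and for $\mathbf x\in K^n$ with all entries non-zero $\mathbf x^{\bullet}=(x_1^{-1},\dots,x_n^{-1})$. $X^T$ is the transpose; juxtaposition is matrix multiplication. The cross product $\mathbf w_1\times\cdots\times\mathbf w_{n-1}\in K^n$ of $n-1$ vectors of $K^n$ is the unique row vector such that $(\mathbf w_1\times\cdots\times\mathbf w_{n-1})\mathbf x^{T}=\det$ of the matrix with rows $\mathbf x,\mathbf w_1,\dots,\mathbf w_{n-1}$ (in this order), for all $\mathbf x\in K^n$. For unital $K$-algebras $A,C$ with multiplications $\mu_A,\mu_C$ and units $\eta_A,\eta_C$, a twisting map of $C$ with $A$ is a $K$-linear map $\chi\colon C\otimes A\to A\otimes C$ such that $\chi\circ(\eta_C\otimes A)=A\otimes\eta_C$, $\chi\circ(C\otimes\eta_A)=\eta_A\otimes C$, $\chi\circ(\mu_C\otimes A)=(A\otimes\mu_C)\circ(\chi\otimes C)\circ(C\otimes\chi)$ and $\chi\circ(C\otimes\mu_A)=(\mu_A\otimes C)\circ(A\otimes\chi)\circ(\chi\otimes A)$. The twisted tensor product algebra $A\otimes_\chi C$ is $A\otimes C$ with multiplication $(\mu_A\otimes\mu_C)\circ(A\otimes\chi\otimes C)$ and unit $1\otimes1$. For a linear map $\chi\colon K^m\otimes K^n\to K^n\otimes K^m$ (here $m=n$), with canonical bases $\{e_i\}$ of $K^m$ and $\{f_j\}$ of $K^n$, write $\chi(e_i\otimes f_j)=\sum_{k,l}\lambda_{ij}^{kl}f_k\otimes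 e_l$; the matrix $A_\chi(i,l)\in M_n(K)$ is defined by $A_\chi(i,l)_{kj}=\lambda_{ij}^{kl}$. *)

theory Defs
  imports "HOL-Analysis.Analysis"
begin

text \<open>
  A vector space with a finite basis indexed by \<open>'i\<close> is represented as \<open>'a^'i\<close>, and the tensor
  product of \<open>'a^'i\<close> and \<open>'a^'j\<close> as \<open>'a^('i \<times> 'j)\<close>, the basis vector with index \<open>(i, j)\<close> being the
  pure tensor of the \<open>i\<close>-th and the \<open>j\<close>-th basis vector. The universal property is proved below
  (\<open>tensor_universal\<close>). As this model is associative only up to reindexing, the associator
  appears explicitly in all formulas.
\<close>

abbreviation vlinear :: "('a::field^'i \<Rightarrow> 'a^'j) \<Rightarrow> bool" where
  "vlinear \<equiv> Vector_Spaces.linear (*s) (*s)"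

definition tensor :: "'a::field^'i \<Rightarrow> 'a^'j \<Rightarrow> 'a^('i \<times> 'j)" (infixl "\<otimes>" 75) where
  "v \<otimes> w = (\<chi> p. v $ fst p * w $ snd p)"

text \<open>The linear map on the tensor product induced by a bilinear map.\<close>

definition tensor_lift ::
    "('a::field^'i \<Rightarrow> 'a^'j \<Rightarrow> 'a^'k) \<Rightarrow> 'a^('i \<times> 'j) \<Rightarrow> 'a^'k" where
  "tensor_lift b t = (\<Sum>i\<in>UNIV. \<Sum>j\<in>UNIV. t $ (i, j) *s b (axis i 1) (axis j 1))"

definition tensor_map ::
    "('a::field^'i \<Rightarrow> 'a^'k) \<Rightarrow> ('a^'j \<Rightarrow> 'a^'l) \<Rightarrow> 'a^('i \<times> 'j) \<Rightarrow> 'a^('k \<times> 'l)" (infixl "\<otimes>\<^sub>m" 75)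
  where "f \<otimes>\<^sub>m g = tensor_lift (\<lambda>v w. f v \<otimes> g w)"

definition tassoc :: "'a::field^(('i::finite \<times> 'j::finite) \<times> 'k::finite) \<Rightarrow> 'a^('i \<times> ('j \<times> 'k))" where
  "tassoc t = (\<chi> p. t $ ((fst p, fst (snd p)), snd (snd p)))"

definition tassoc_inv :: "'a::field^('i::finite \<times> ('j::finite \<times> 'k::finite)) \<Rightarrow> 'a^(('i \<times> 'j) \<times> 'k)" where
  "tassoc_inv t = (\<chi> p. t $ (fst (fst p), (snd (fst p), snd p)))"

lemma vlinear_tensor_lift: "vlinear (tensor_lift b)"
  unfolding tensor_lift_def
  by unfold_locales
    (simp_all add: vec.scale_left_distrib sum.distrib vec.scale_sum_right
      vec.scale_right_distrib)

lemma tensor_lift_tensor: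
  fixes b :: "'a::field^'i \<Rightarrow> 'a^'j \<Rightarrow> 'a^'k"
  assumes "\<And>x. vlinear (b x)" "\<And>y. vlinear (\<lambda>x. b x y)"
  shows "tensor_lift b (v \<otimes> w) = b v w"
proof -
  interpret r: Vector_Spaces.linear "(*s)" "(*s)" "b x" for x by (rule assms)
  interpret l: Vector_Spaces.linear "(*s)" "(*s)" "\<lambda>x. b x y" for y by (rule assms)
  have "b v w = b (\<Sum>i\<in>UNIV. (v $ i) *s axis i 1) (\<Sum>j\<in>UNIV. (w $ j) *s axis j 1)"
    by (simp only: basis_expansion)
  also have "\<dots> = tensor_lift b (v \<otimes> w)"
    unfolding tensor_lift_def tensor_def
    by (subst sum.swap) (simp add: l.sum r.sum l.scale r.scale vec.scale_sum_right mult.commute)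
  finally show ?thesis by simp
qed

lemma axis_tensor_axis: "axis i 1 \<otimes> axis j 1 = (axis (i, j) 1 :: 'a::field^('i::finite \<times> 'j::finite))"
  by (auto simp: tensor_def axis_def vec_eq_iff)

theorem tensor_universal:
  fixes b :: "'a::field^'i \<Rightarrow> 'a^'j \<Rightarrow> 'a^'k"
  assumes "\<And>x. vlinear (b x)" "\<And>y. vlinear (\<lambda>x. b x y)"
  shows "\<exists>!f. vlinear f \<and> (\<forall>v w. f (v \<otimes> w) = b v w)"
proof (rule ex1I)
  show "vlinear (tensor_lift b) \<and> (\<forall>v w. tensor_lift b (v \<otimes> w) = b v w)"
    by (simp add: vlinear_tensor_lift tensor_lift_tensor assms)
next
  fix f assume f: "vlinear f \<and> (\<forall>v w. f (v \<otimes> w) = b v w)"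
  then interpret Vector_Spaces.linear "(*s)" "(*s)" f by blast
  show "f = tensor_lift b"
  proof
    fix t :: "'a^('i \<times> 'j)"
    have "f t = f (\<Sum>p\<in>UNIV. (t $ p) *s axis p 1)" by (simp only: basis_expansion)
    also have "\<dots> = (\<Sum>p\<in>UNIV \<times> UNIV. (t $ p) *s f (axis p 1))" by (simp add: sum scale)
    also have "\<dots> = (\<Sum>i\<in>UNIV. \<Sum>j\<in>UNIV. (t $ (i, j)) *s f (axis (i, j) 1))"
      by (subst sum.cartesian_product) (auto intro: sum.cong)
    also have "\<dots> = tensor_lift b t"
      using f by (simp add: tensor_lift_def flip: axis_tensor_axis)
    finally show "f t = tensor_lift b t" .
  qed
qed

lemma vlinear_tensor_map: "vlinear (f \<otimes>\<^sub>m g)"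
  unfolding tensor_map_def by (rule vlinear_tensor_lift)

lemma tensor_map_tensor:
  assumes "vlinear f" "vlinear g"
  shows "(f \<otimes>\<^sub>m g) (v \<otimes> w) = f v \<otimes> g w"
proof -
  interpret f: Vector_Spaces.linear "(*s)" "(*s)" f by (rule assms)
  interpret g: Vector_Spaces.linear "(*s)" "(*s)" g by (rule assms)
  show ?thesis unfolding tensor_map_def
    by (rule tensor_lift_tensor; unfold_locales)
      (simp_all add: tensor_def vec_eq_iff f.add f.scale g.add g.scale algebra_simps)
qed

lemma vlinear_eqI:
  assumes "vlinear f" "vlinear g" "\<And>i. f (axis i 1) = g (axis i 1)"
  shows "f = g"
proof
  interpret f: Vector_Spaces.linear "(*s)" "(*s)" f by (rule assms)
  interpret g: Vector_Spaces.linear "(*s)" "(*s)" g by (rule assms)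
  fix x
  have "f (\<Sum>i\<in>UNIV. (x $ i) *s axis i 1) = g (\<Sum>i\<in>UNIV. (x $ i) *s axis i 1)"
    by (simp add: f.sum g.sum f.scale g.scale assms(3))
  thus "f x = g x" by (simp only: basis_expansion)
qed

lemma vlinear_comp: "vlinear f \<Longrightarrow> vlinear g \<Longrightarrow> vlinear (g \<circ> f)"
  by (rule Vector_Spaces.linear_compose)

lemma vlinear_tassoc: "vlinear tassoc"
  by unfold_locales (simp_all add: tassoc_def vec_eq_iff algebra_simps)

lemma vlinear_tassoc_inv: "vlinear tassoc_inv"
  by unfold_locales (simp_all add: tassoc_inv_def vec_eq_iff algebra_simps)

lemma tassoc_tensor: "tassoc ((u \<otimes> v) \<otimes> w) = u \<otimes> (v \<otimes> w)"
  by (simp add: tassoc_def tensor_def vec_eq_iff mult.assoc)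

lemma tassoc_inv_tassoc: "tassoc_inv (tassoc t) = t" "tassoc (tassoc_inv s) = s"
  by (simp_all add: tassoc_def tassoc_inv_def vec_eq_iff)

text \<open>
  A unital algebra on \<open>'a^'i\<close> is given by its multiplication, a linear map
  \<open>'a^('i \<times> 'i) \<Rightarrow> 'a^'i\<close>, and the image of \<open>1\<close> under its unit map.
\<close>

definition unital_algebra :: "('a::field^('i \<times> 'i) \<Rightarrow> 'a^'i) \<Rightarrow> 'a^'i \<Rightarrow> bool" where
  "unital_algebra \<mu> u \<longleftrightarrow>
     vlinear \<mu> \<and> \<mu> \<circ> (\<mu> \<otimes>\<^sub>m id) = \<mu> \<circ> (id \<otimes>\<^sub>m \<mu>) \<circ> tassoc \<and>
     (\<forall>x. \<mu> (u \<otimes> x) = x) \<and> (\<forall>x. \<mu> (x \<otimes> u) = x)"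

text \<open>
  The two unit conditions below are the identities for the unit maps of \<open>C\<close> and of \<open>A\<close>, up to
  the canonical identification of a space with its tensor product with the field.
\<close>

definition twisting_map ::
    "('a::field^('c \<times> 'c) \<Rightarrow> 'a^'c) \<Rightarrow> 'a^'c \<Rightarrow> ('a^('b \<times> 'b) \<Rightarrow> 'a^'b) \<Rightarrow> 'a^'b
      \<Rightarrow> ('a^('c \<times> 'b) \<Rightarrow> 'a^('b \<times> 'c)) \<Rightarrow> bool" where
  "twisting_map \<mu>C uC \<mu>A uA \<xi> \<longleftrightarrow>
     unital_algebra \<mu>C uC \<and> unital_algebra \<mu>A uA \<and> vlinear \<xi> \<and>
     (\<forall>x. \<xi> (uC \<otimes> x) = x \<otimes> uC) \<and>
     (\<forall>y. \<xi> (y \<otimes> uA) = uA \<otimes> y) \<and>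
     \<xi> \<circ> (\<mu>C \<otimes>\<^sub>m id) =
       (id \<otimes>\<^sub>m \<mu>C) \<circ> tassoc \<circ> (\<xi> \<otimes>\<^sub>m id) \<circ> tassoc_inv \<circ> (id \<otimes>\<^sub>m \<xi>) \<circ> tassoc \<and>
     \<xi> \<circ> (id \<otimes>\<^sub>m \<mu>A) =
       (\<mu>A \<otimes>\<^sub>m id) \<circ> tassoc_inv \<circ> (id \<otimes>\<^sub>m \<xi>) \<circ> tassoc \<circ> (\<xi> \<otimes>\<^sub>m id) \<circ> tassoc_inv"

text \<open>
  The multiplication of the twisted tensor product. The last line only reassociates
  \<open>(A \<otimes> C) \<otimes> (A \<otimes> C)\<close> to \<open>A \<otimes> ((C \<otimes> A) \<otimes> C)\<close>, and the second one
  \<open>A \<otimes> ((A \<otimes> C) \<otimes> C)\<close> to \<open>(A \<otimes> A) \<otimes> (C \<otimes> C)\<close>.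
\<close>

definition twisted_mult ::
    "('a::field^('c \<times> 'c) \<Rightarrow> 'a^'c) \<Rightarrow> ('a^('b \<times> 'b) \<Rightarrow> 'a^'b)
      \<Rightarrow> ('a^('c \<times> 'b) \<Rightarrow> 'a^('b \<times> 'c))
      \<Rightarrow> 'a^(('b \<times> 'c) \<times> ('b \<times> 'c)) \<Rightarrow> 'a^('b \<times> 'c)" where
  "twisted_mult \<mu>C \<mu>A \<xi> =
     (\<mu>A \<otimes>\<^sub>m \<mu>C) \<circ>
     (tassoc_inv \<circ> (id \<otimes>\<^sub>m tassoc)) \<circ>
     (id \<otimes>\<^sub>m (\<xi> \<otimes>\<^sub>m id)) \<circ>
     ((id \<otimes>\<^sub>m tassoc_inv) \<circ> tassoc)"

lemma twisted_mult_tensor: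
  assumes "vlinear \<mu>C" "vlinear \<mu>A" "vlinear \<xi>" "\<xi> (c \<otimes> a') = a'' \<otimes> c''"
  shows "twisted_mult \<mu>C \<mu>A \<xi> ((a \<otimes> c) \<otimes> (a' \<otimes> c')) = \<mu>A (a \<otimes> a'') \<otimes> \<mu>C (c'' \<otimes> c')"
proof -
  have inv: "tassoc_inv (x \<otimes> (y \<otimes> z)) = (x \<otimes> y) \<otimes> z"
    for x :: "'a::field^'d" and y :: "'a^'e" and z :: "'a^'f"
    by (simp add: tassoc_inv_tassoc flip: tassoc_tensor)
  show ?thesis
    by (simp add: twisted_mult_def assms tassoc_tensor inv tensor_map_tensor vec.linear_id
        vlinear_tensor_map vlinear_tassoc vlinear_tassoc_inv)
qed

definition algebra_isomorphic ::
    "('a::field \<Rightarrow> 'v::ab_group_add \<Rightarrow> 'v) \<Rightarrow> ('v \<Rightarrow> 'v \<Rightarrow> 'v) \<Rightarrow> 'v \<Rightarrow>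
     ('a \<Rightarrow> 'w::ab_group_add \<Rightarrow> 'w) \<Rightarrow> ('w \<Rightarrow> 'w \<Rightarrow> 'w) \<Rightarrow> 'w \<Rightarrow> bool" where
  "algebra_isomorphic s m u s' m' u' \<longleftrightarrow>
     (\<exists>\<Phi> :: 'v \<Rightarrow> 'w. Vector_Spaces.linear s s' \<Phi> \<and> bij \<Phi> \<and>
        (\<forall>x y. \<Phi> (m x y) = m' (\<Phi> x) (\<Phi> y)) \<and> \<Phi> u = u')"

text \<open>On \<open>'a^'n\<close>, \<open>(*)\<close> is entrywise and \<open>1\<close> is the vector of ones.\<close>

abbreviation entry_mult :: "'a::field^('n \<times> 'n) \<Rightarrow> 'a^'n" where
  "entry_mult \<equiv> tensor_lift (*)"

lemma entry_mult_nth: "entry_mult t $ i = t $ (i, i)"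
proof -
  have "entry_mult t $ i = (\<Sum>k\<in>UNIV. \<Sum>j\<in>UNIV. if k = i then if j = i then t $ (k, j) else 0 else 0)"
    unfolding tensor_lift_def sum_component by (intro sum.cong refl) (simp add: axis_def)
  also have "\<dots> = (\<Sum>k\<in>UNIV. if k = i then t $ (k, i) else 0)"
    by (intro sum.cong) auto
  also have "\<dots> = t $ (i, i)" by simp
  finally show ?thesis .
qed

lemma entry_mult_tensor: "entry_mult (x \<otimes> y) = x * y"
  by (simp add: entry_mult_nth tensor_def vec_eq_iff)

lemma unital_algebra_entry_mult: "unital_algebra (entry_mult :: 'a::field^('n::finite \<times> 'n) \<Rightarrow> 'a^'n) 1"
proof -
  let ?m = "entry_mult :: 'a^('n \<times> 'n) \<Rightarrow> 'a^'n"
  have lin: "vlinear ?m" "vlinear (id :: 'a^'n \<Rightarrow> 'a^'n)"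
    by (rule vlinear_tensor_lift, rule vec.linear_id)
  have "?m \<circ> (?m \<otimes>\<^sub>m id) = ?m \<circ> (id \<otimes>\<^sub>m ?m) \<circ> tassoc"
  proof (rule vlinear_eqI)
    show "vlinear (?m \<circ> (?m \<otimes>\<^sub>m id))" "vlinear (?m \<circ> (id \<otimes>\<^sub>m ?m) \<circ> tassoc)"
      by (rule vlinear_comp[OF vlinear_tensor_map vlinear_tensor_lift],
          rule vlinear_comp[OF vlinear_tassoc vlinear_comp[OF vlinear_tensor_map vlinear_tensor_lift]])
    fix p :: "('n \<times> 'n) \<times> 'n"
    obtain i j k where "p = ((i, j), k)" by (metis surj_pair)
    hence "axis p (1::'a) = axis i 1 \<otimes> axis j 1 \<otimes> axis k 1" by (simp add: axis_tensor_axis)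
    thus "(?m \<circ> (?m \<otimes>\<^sub>m id)) (axis p 1) = (?m \<circ> (id \<otimes>\<^sub>m ?m) \<circ> tassoc) (axis p 1)"
      by (simp add: tensor_map_tensor lin tassoc_tensor entry_mult_tensor mult.assoc)
  qed
  with lin show ?thesis by (simp add: unital_algebra_def entry_mult_tensor)
qed

definition bullet_inv :: "'a::field^'n \<Rightarrow> 'a^'n" where
  "bullet_inv x = (\<chi> i. inverse (x $ i))"

text \<open>
  The index set \<open>{1..n}\<close> is an arbitrary finite linearly ordered type; \<open>idx_pos i\<close> is the position
  of \<open>i\<close> counted from \<open>0\<close>, that is, \<open>i - 1\<close> in the usual numbering.
\<close>

definition idx_pos :: "'n::{finite,linorder} \<Rightarrow> nat" where
  "idx_pos i = card {..<i}"

definition matrix_of_rows :: "('a::field^'n::{finite,linorder}) list \<Rightarrow> ('a^'n::_)^'n::_" where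
  "matrix_of_rows xs = (\<chi> k. xs ! idx_pos k)"

text \<open>Meaningful for lists of length \<open>CARD('n) - 1\<close>.\<close>

definition cross_product :: "('a::field^'n::{finite,linorder}) list \<Rightarrow> 'a^'n::_" where
  "cross_product ws = (THE w. \<forall>x. scalar_product w x = det (matrix_of_rows (x # ws)))"

lemma idx_pos_eq_0_iff: "idx_pos (k :: 'n::{finite,linorder}) = 0 \<longleftrightarrow> k = Min UNIV"
proof
  assume "idx_pos k = 0"
  hence "{..<k} = {}" by (simp add: idx_pos_def)
  hence "\<forall>j. k \<le> j" by (metis empty_iff lessThan_iff not_le)
  thus "k = Min UNIV" by (intro Min_eqI[symmetric]) auto
next
  assume "k = Min UNIV"
  hence "{..<k} = {}" by (auto simp: not_less)
  thus "idx_pos k = 0" by (simp add: idx_pos_def)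
qed

lemma cross_product_ex1:
  fixes ws :: "('a::field^'n::{finite,linorder}) list"
  shows "\<exists>!w. \<forall>x. scalar_product w x = det (matrix_of_rows (x # ws))"
proof -
  define D where "D x = det (matrix_of_rows (x # ws))" for x
  have D: "D x = det (\<chi> k. if k = Min UNIV then x else ws ! (idx_pos k - 1))" for x
    unfolding D_def matrix_of_rows_def
    by (intro arg_cong[where f = det]) (auto simp: vec_eq_iff nth_Cons' idx_pos_eq_0_iff)
  interpret Vector_Spaces.linear "(*s)" "(*)" D
    by unfold_locales (simp_all add: D det_row_add det_row_mul algebra_simps)
  have exp: "D x = scalar_product (\<chi> i. D (axis i 1)) x" for x
  proof -
    have "D x = D (\<Sum>i\<in>UNIV. (x $ i) *s axis i 1)" by (simp only: basis_expansion)
    thus ?thesis by (simp add: sum scale scalar_product_def mult.commute)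
  qed
  have coord: "scalar_product w (axis i 1) = w $ i" for w :: "'a^'n::_" and i
    by (simp add: scalar_product_def axis_def if_distrib[of "(*) _"] cong: if_cong)
  show ?thesis
  proof (rule ex1I)
    show "\<forall>x. scalar_product (\<chi> i. D (axis i 1)) x = det (matrix_of_rows (x # ws))"
      using exp unfolding D_def by metis
    fix w assume "\<forall>x. scalar_product w x = det (matrix_of_rows (x # ws))"
    hence "w $ i = D (axis i 1)" for i unfolding D_def by (metis coord)
    thus "w = (\<chi> i. D (axis i 1))" by (simp add: vec_eq_iff)
  qed
qed

definition cross_omit :: "('n::{finite,linorder} \<Rightarrow> 'a::field^'n::_) \<Rightarrow> 'n \<Rightarrow> 'a^'n::_" where
  "cross_omit v i = cross_product (map v (filter (\<lambda>j. j \<noteq> i) (sorted_list_of_set UNIV)))"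

text \<open>
  The matrix \<open>A\<^sub>\<xi>(i,l)\<close>: its \<open>(k, j)\<close> entry is the coefficient of the basis tensor with index
  \<open>(k, l)\<close> in the image under \<open>\<xi>\<close> of the basis tensor with index \<open>(i, j)\<close>.
\<close>

definition twist_matrix ::
    "('a::field^('m::finite \<times> 'n::finite) \<Rightarrow> 'a^('n \<times> 'm)) \<Rightarrow> 'm \<Rightarrow> 'm \<Rightarrow> 'a^'n^'n" where
  "twist_matrix \<xi> i l = (\<chi> k j. \<xi> (axis i 1 \<otimes> axis j 1) $ (k, l))"

definition mat_scale :: "'a::field \<Rightarrow> 'a^'n^'m \<Rightarrow> 'a^'n^'m" where
  "mat_scale c A = (\<chi> i j. c * A $ i $ j)"

end

theory Submission
  imports Defs
begin

text \<open>
  Suppose that an algebra \<open>B\<close> contains homomorphic images of two algebras \<open>A\<close> and \<open>C\<close> such that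
  \<open>a \<otimes> c \<mapsto> \<alpha> a \<odot> \<gamma> c\<close> is a linear bijection \<open>\<Phi>\<close> from the tensor product onto \<open>B\<close>. Pulling the
  product of \<open>B\<close> back along \<open>\<Phi>\<close> makes the tensor product an algebra isomorphic to \<open>B\<close>, and the map
  \<open>\<xi>\<close> that rewrites a product in the wrong order, \<open>\<Phi> (\<xi> (c \<otimes> a)) = \<gamma> c \<odot> \<alpha> a\<close>, satisfies the
  twisting axioms because \<open>B\<close> is associative. Such data form the locale
  \<open>algebra_factorization\<close>; its results \<open>twisting_map\<close> and \<open>isomorphic_twisted\<close> reduce the theorem
  to finding a suitable factorization of the matrix algebra.

  Let \<open>V\<close> be the matrix with columns \<open>v\<^sub>1, \<dots>, v\<^sub>n\<close> and \<open>U\<close> its inverse. The matrix algebra is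
  factored into the diagonal matrices \<open>diag a\<close> and their conjugates \<open>V ** diag c ** U\<close>. Row \<open>k\<close> of
  the image of \<open>t\<close> under \<open>\<Phi>\<close> is the combination of the rows of \<open>U\<close> with coefficients
  \<open>t\<^bsub>kl\<^esub> V\<^bsub>kl\<^esub>\<close>. As the rows of \<open>U\<close> form a basis, \<open>\<Phi>\<close> is bijective exactly because no entry of
  \<open>V\<close> vanishes. Comparing coefficients in \<open>\<Phi> (\<xi> (c \<otimes> a)) = V ** diag c ** U ** diag a\<close> gives
  \<open>\<lambda>\<^bsub>ij\<^esub>\<^bsup>kl\<^esup> = V\<^bsub>kl\<^esub>\<inverse> V\<^bsub>ki\<^esub> V\<^bsub>jl\<^esub> U\<^bsub>ij\<^esub>\<close>
  (\<open>matrix_algebra_factorization\<close>).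

  This is the prescribed twist matrix because row \<open>i\<close> of \<open>U\<close> is \<open>(-1)\<^bsup>i-1\<^esup>\<close> times the cross product
  of the \<open>v\<^sub>j\<close> with \<open>j \<noteq> i\<close> (\<open>cross_omit_inverse\<close>): pairing that cross product with \<open>x\<close> gives a
  determinant with \<open>x\<close> in the first row, and moving \<open>x\<close> down to position \<open>i\<close> costs the sign, so that
  \<open>x = v\<^sub>i\<close> yields the determinant of \<open>V\<close> and \<open>x = v\<^sub>j\<close> with \<open>j \<noteq> i\<close> yields a determinant with two
  equal rows. Uniqueness of \<open>\<xi>\<close> is clear, since the twist matrices list all its coefficients.
\<close>

section \<open>Linear maps on tensor products\<close>

text \<open>
  The codomain is an arbitrary vector space, so that the principle applies to maps into a space of
  matrices, which is not of the form \<open>'a^'j\<close> over the field.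
\<close>

lemma linear_eq_on_axes:
  fixes f g :: "'a::field^'i::finite \<Rightarrow> 'b::ab_group_add" and scale
  assumes "Vector_Spaces.linear (*s) scale f" "Vector_Spaces.linear (*s) scale g"
    and "\<And>i. f (axis i 1) = g (axis i 1)"
  shows "f t = g t"
proof -
  interpret f: Vector_Spaces.linear "(*s)" scale f by (rule assms)
  interpret g: Vector_Spaces.linear "(*s)" scale g by (rule assms)
  have "f (\<Sum>i\<in>UNIV. (t $ i) *s axis i 1) = g (\<Sum>i\<in>UNIV. (t $ i) *s axis i 1)"
    by (simp add: f.sum g.sum f.scale g.scale assms(3))
  thus ?thesis by (simp only: basis_expansion)
qed

lemma linear_eq_on_tensors:
  fixes f g :: "'a::field^('i::finite \<times> 'j::finite) \<Rightarrow> 'b::ab_group_add" and scale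
  assumes "Vector_Spaces.linear (*s) scale f" "Vector_Spaces.linear (*s) scale g"
    and "\<And>x y. f (x \<otimes> y) = g (x \<otimes> y)"
  shows "f t = g t"
proof (rule linear_eq_on_axes[OF assms(1,2)])
  fix p :: "'i \<times> 'j"
  show "f (axis p 1) = g (axis p 1)"
    by (cases p) (metis assms(3) axis_tensor_axis)
qed

lemma linear_fun_comp:
  "Vector_Spaces.linear s1 s2 f \<Longrightarrow> Vector_Spaces.linear s2 s3 g \<Longrightarrow>
    Vector_Spaces.linear s1 s3 (\<lambda>x. g (f x))"
  using Vector_Spaces.linear_compose[of s1 s2 f s3 g] by (simp add: comp_def)

lemma vlinear_tensor_left: "vlinear (\<lambda>x. x \<otimes> y)"
  by unfold_locales (simp_all add: tensor_def vec_eq_iff algebra_simps)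

lemma vlinear_tensor_right: "vlinear (\<lambda>y. x \<otimes> y)"
  by unfold_locales (simp_all add: tensor_def vec_eq_iff algebra_simps)

lemma tassoc_inv_tensor: "tassoc_inv (x \<otimes> (y \<otimes> z)) = x \<otimes> y \<otimes> z"
  by (simp add: tassoc_inv_tassoc flip: tassoc_tensor)

section \<open>Algebra factorizations\<close>

text \<open>
  Here \<open>B\<close> is the algebra \<open>(scale, mult, unit)\<close>, with \<open>\<alpha>\<close> and \<open>\<gamma>\<close> the homomorphisms into it. Their
  linearity is implied by that of \<open>\<Phi>\<close>, because \<open>\<alpha> a = \<Phi> (a \<otimes> uC)\<close> and \<open>\<gamma> c = \<Phi> (uA \<otimes> c)\<close>.
\<close>

locale algebra_factorization =
  fixes scale :: "'a::field \<Rightarrow> 'd::ab_group_add \<Rightarrow> 'd"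
    and mult :: "'d \<Rightarrow> 'd \<Rightarrow> 'd" (infixl "\<odot>" 70)
    and unit :: 'd
    and \<mu>A :: "'a^('b::finite \<times> 'b) \<Rightarrow> 'a^'b" and uA :: "'a^'b"
    and \<mu>C :: "'a^('c::finite \<times> 'c) \<Rightarrow> 'a^'c" and uC :: "'a^'c"
    and \<alpha> :: "'a^'b \<Rightarrow> 'd" and \<gamma> :: "'a^'c \<Rightarrow> 'd"
    and \<Phi> :: "'a^('b \<times> 'c) \<Rightarrow> 'd"
    and \<xi> :: "'a^('c \<times> 'b) \<Rightarrow> 'a^('b \<times> 'c)"
  assumes assoc: "x \<odot> y \<odot> z = x \<odot> (y \<odot> z)"
    and unit_left: "unit \<odot> x = x" and unit_right: "x \<odot> unit = x"
    and linear_left: "Vector_Spaces.linear scale scale (\<lambda>x. x \<odot> y)"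
    and linear_right: "Vector_Spaces.linear scale scale (\<lambda>y. x \<odot> y)"
    and algebra_A: "unital_algebra \<mu>A uA" and algebra_C: "unital_algebra \<mu>C uC"
    and \<alpha>_mult: "\<alpha> (\<mu>A (a \<otimes> a')) = \<alpha> a \<odot> \<alpha> a'" and \<alpha>_unit: "\<alpha> uA = unit"
    and \<gamma>_mult: "\<gamma> (\<mu>C (c \<otimes> c')) = \<gamma> c \<odot> \<gamma> c'" and \<gamma>_unit: "\<gamma> uC = unit"
    and linear_\<Phi>: "Vector_Spaces.linear (*s) scale \<Phi>"
    and bij_\<Phi>: "bij \<Phi>"
    and \<Phi>_tensor: "\<Phi> (a \<otimes> c) = \<alpha> a \<odot> \<gamma> c"
    and linear_\<xi>: "vlinear \<xi>"
    and \<Phi>_\<xi>: "\<Phi> (\<xi> (c \<otimes> a)) = \<gamma> c \<odot> \<alpha> a"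
begin

lemma \<Phi>_eqD: "\<Phi> s = \<Phi> t \<Longrightarrow> s = t"
  using bij_\<Phi> by (auto dest: bij_is_inj injD)

lemma linear_mults: "vlinear \<mu>A" "vlinear \<mu>C"
  using algebra_A algebra_C by (simp_all add: unital_algebra_def)

lemmas linears = linear_mults linear_\<xi> vec.linear_id vlinear_tassoc vlinear_tassoc_inv
  vlinear_tensor_map vlinear_tensor_left vlinear_tensor_right linear_left linear_right

text \<open>
  Through \<open>\<Phi>\<close>, each map of the twisting axioms and of the twisted product becomes a multiplication in
  \<open>B\<close>. The next lemmas translate them one at a time; each holds on pure tensors by associativity
  and extends linearly in the one argument that is a general tensor.
\<close>

lemma \<Phi>_mult_right: "\<Phi> ((id \<otimes>\<^sub>m \<mu>C) (tassoc (s \<otimes> c))) = \<Phi> s \<odot> \<gamma> c"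
proof (rule linear_eq_on_tensors[where t = s and scale = scale
      and f = "\<lambda>s. \<Phi> ((id \<otimes>\<^sub>m \<mu>C) (tassoc (s \<otimes> c)))"
      and g = "\<lambda>s. \<Phi> s \<odot> \<gamma> c"])
  show "Vector_Spaces.linear (*s) scale (\<lambda>s. \<Phi> ((id \<otimes>\<^sub>m \<mu>C) (tassoc (s \<otimes> c))))"
    by (rule vlinear_tensor_left[THEN linear_fun_comp, OF vlinear_tassoc,
        THEN linear_fun_comp, OF vlinear_tensor_map, THEN linear_fun_comp, OF linear_\<Phi>])
  show "Vector_Spaces.linear (*s) scale (\<lambda>s. \<Phi> s \<odot> \<gamma> c)"
    by (rule linear_\<Phi>[THEN linear_fun_comp, OF linear_left])
qed (simp add: tassoc_tensor tensor_map_tensor linears \<Phi>_tensor \<gamma>_mult assoc)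

lemma \<Phi>_mult_left: "\<Phi> ((\<mu>A \<otimes>\<^sub>m id) (tassoc_inv (a \<otimes> s))) = \<alpha> a \<odot> \<Phi> s"
proof (rule linear_eq_on_tensors[where t = s and scale = scale
      and f = "\<lambda>s. \<Phi> ((\<mu>A \<otimes>\<^sub>m id) (tassoc_inv (a \<otimes> s)))"
      and g = "\<lambda>s. \<alpha> a \<odot> \<Phi> s"])
  show "Vector_Spaces.linear (*s) scale (\<lambda>s. \<Phi> ((\<mu>A \<otimes>\<^sub>m id) (tassoc_inv (a \<otimes> s))))"
    by (rule vlinear_tensor_right[THEN linear_fun_comp, OF vlinear_tassoc_inv,
        THEN linear_fun_comp, OF vlinear_tensor_map, THEN linear_fun_comp, OF linear_\<Phi>])
  show "Vector_Spaces.linear (*s) scale (\<lambda>s. \<alpha> a \<odot> \<Phi> s)"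
    by (rule linear_\<Phi>[THEN linear_fun_comp, OF linear_right])
qed (simp add: tassoc_inv_tensor tensor_map_tensor linears \<Phi>_tensor \<alpha>_mult assoc)

lemma \<Phi>_swap_left:
  "\<Phi> ((id \<otimes>\<^sub>m \<mu>C) (tassoc ((\<xi> \<otimes>\<^sub>m id) (tassoc_inv (c \<otimes> t))))) = \<gamma> c \<odot> \<Phi> t"
proof (rule linear_eq_on_tensors[where t = t and scale = scale
      and f = "\<lambda>t. \<Phi> ((id \<otimes>\<^sub>m \<mu>C) (tassoc ((\<xi> \<otimes>\<^sub>m id) (tassoc_inv (c \<otimes> t)))))"
      and g = "\<lambda>t. \<gamma> c \<odot> \<Phi> t"])
  show "Vector_Spaces.linear (*s) scale
      (\<lambda>t. \<Phi> ((id \<otimes>\<^sub>m \<mu>C) (tassoc ((\<xi> \<otimes>\<^sub>m id) (tassoc_inv (c \<otimes> t))))))"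
    by (rule vlinear_tensor_right[THEN linear_fun_comp, OF vlinear_tassoc_inv,
        THEN linear_fun_comp, OF vlinear_tensor_map, THEN linear_fun_comp, OF vlinear_tassoc,
        THEN linear_fun_comp, OF vlinear_tensor_map, THEN linear_fun_comp, OF linear_\<Phi>])
  show "Vector_Spaces.linear (*s) scale (\<lambda>t. \<gamma> c \<odot> \<Phi> t)"
    by (rule linear_\<Phi>[THEN linear_fun_comp, OF linear_right])
qed (simp add: tassoc_inv_tensor tensor_map_tensor linears \<Phi>_mult_right \<Phi>_\<xi> \<Phi>_tensor
    flip: assoc)

lemma \<Phi>_swap_right:
  "\<Phi> ((\<mu>A \<otimes>\<^sub>m id) (tassoc_inv ((id \<otimes>\<^sub>m \<xi>) (tassoc (t \<otimes> a))))) = \<Phi> t \<odot> \<alpha> a"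
proof (rule linear_eq_on_tensors[where t = t and scale = scale
      and f = "\<lambda>t. \<Phi> ((\<mu>A \<otimes>\<^sub>m id) (tassoc_inv ((id \<otimes>\<^sub>m \<xi>) (tassoc (t \<otimes> a)))))"
      and g = "\<lambda>t. \<Phi> t \<odot> \<alpha> a"])
  show "Vector_Spaces.linear (*s) scale
      (\<lambda>t. \<Phi> ((\<mu>A \<otimes>\<^sub>m id) (tassoc_inv ((id \<otimes>\<^sub>m \<xi>) (tassoc (t \<otimes> a))))))"
    by (rule vlinear_tensor_left[THEN linear_fun_comp, OF vlinear_tassoc,
        THEN linear_fun_comp, OF vlinear_tensor_map, THEN linear_fun_comp, OF vlinear_tassoc_inv,
        THEN linear_fun_comp, OF vlinear_tensor_map, THEN linear_fun_comp, OF linear_\<Phi>])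
  show "Vector_Spaces.linear (*s) scale (\<lambda>t. \<Phi> t \<odot> \<alpha> a)"
    by (rule linear_\<Phi>[THEN linear_fun_comp, OF linear_left])
qed (simp add: tassoc_tensor tensor_map_tensor linears \<Phi>_mult_left \<Phi>_\<xi> \<Phi>_tensor assoc)

text \<open>
  In both multiplicativity axioms the two sides have the same image in \<open>B\<close>, namely
  \<open>\<gamma> c \<odot> \<gamma> c' \<odot> \<alpha> a\<close> and \<open>\<gamma> c \<odot> \<alpha> a \<odot> \<alpha> a'\<close> respectively, and \<open>\<Phi>\<close> is injective.
\<close>

lemma twisting_map: "twisting_map \<mu>C uC \<mu>A uA \<xi>"
  unfolding twisting_map_def
proof (intro conjI allI)
  fix x y
  show "\<xi> (uC \<otimes> x) = x \<otimes> uC" "\<xi> (y \<otimes> uA) = uA \<otimes> y"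
    by (rule \<Phi>_eqD, simp add: \<Phi>_\<xi> \<Phi>_tensor \<alpha>_unit \<gamma>_unit unit_left unit_right)+
next
  let ?f = "\<xi> \<circ> (\<mu>C \<otimes>\<^sub>m id)"
  let ?g = "(id \<otimes>\<^sub>m \<mu>C) \<circ> tassoc \<circ> (\<xi> \<otimes>\<^sub>m id) \<circ> tassoc_inv \<circ> (id \<otimes>\<^sub>m \<xi>) \<circ> tassoc"
  show "?f = ?g"
  proof (rule vlinear_eqI)
    show "vlinear ?f" "vlinear ?g"
      by (intro vlinear_comp linears)+
    fix p :: "('c \<times> 'c) \<times> 'b"
    obtain i j k where "p = ((i, j), k)" by (metis surj_pair)
    hence "axis p (1::'a) = axis i 1 \<otimes> axis j 1 \<otimes> axis k 1" by (simp add: axis_tensor_axis)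
    thus "?f (axis p 1) = ?g (axis p 1)"
      by (intro \<Phi>_eqD)
        (simp add: tassoc_tensor tensor_map_tensor linears \<Phi>_swap_left \<Phi>_\<xi> \<gamma>_mult assoc)
  qed
next
  let ?f = "\<xi> \<circ> (id \<otimes>\<^sub>m \<mu>A)"
  let ?g = "(\<mu>A \<otimes>\<^sub>m id) \<circ> tassoc_inv \<circ> (id \<otimes>\<^sub>m \<xi>) \<circ> tassoc \<circ> (\<xi> \<otimes>\<^sub>m id) \<circ> tassoc_inv"
  show "?f = ?g"
  proof (rule vlinear_eqI)
    show "vlinear ?f" "vlinear ?g"
      by (intro vlinear_comp linears)+
    fix p :: "'c \<times> ('b \<times> 'b)"
    obtain i j k where "p = (i, (j, k))" by (metis surj_pair)
    hence "axis p (1::'a) = axis i 1 \<otimes> (axis j 1 \<otimes> axis k 1)" by (simp add: axis_tensor_axis)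
    thus "?f (axis p 1) = ?g (axis p 1)"
      by (intro \<Phi>_eqD)
        (simp add: tassoc_inv_tensor tensor_map_tensor linears \<Phi>_swap_right \<Phi>_\<xi> \<alpha>_mult assoc)
  qed
qed (fact algebra_A algebra_C linear_\<xi>)+

lemma \<Phi>_mult_both:
  "\<Phi> ((\<mu>A \<otimes>\<^sub>m \<mu>C) (tassoc_inv (a \<otimes> tassoc (t \<otimes> c)))) = \<alpha> a \<odot> \<Phi> t \<odot> \<gamma> c"
proof (rule linear_eq_on_tensors[where t = t and scale = scale
      and f = "\<lambda>t. \<Phi> ((\<mu>A \<otimes>\<^sub>m \<mu>C) (tassoc_inv (a \<otimes> tassoc (t \<otimes> c))))"
      and g = "\<lambda>t. \<alpha> a \<odot> \<Phi> t \<odot> \<gamma> c"])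
  show "Vector_Spaces.linear (*s) scale (\<lambda>t. \<Phi> ((\<mu>A \<otimes>\<^sub>m \<mu>C) (tassoc_inv (a \<otimes> tassoc (t \<otimes> c)))))"
    by (rule vlinear_tensor_left[THEN linear_fun_comp, OF vlinear_tassoc,
        THEN linear_fun_comp, OF vlinear_tensor_right,
        THEN linear_fun_comp, OF vlinear_tassoc_inv, THEN linear_fun_comp, OF vlinear_tensor_map,
        THEN linear_fun_comp, OF linear_\<Phi>])
  show "Vector_Spaces.linear (*s) scale (\<lambda>t. \<alpha> a \<odot> \<Phi> t \<odot> \<gamma> c)"
    by (rule linear_\<Phi>[THEN linear_fun_comp, OF linear_right,
        THEN linear_fun_comp, OF linear_left])
qed (simp add: tassoc_tensor tassoc_inv_tensor tensor_map_tensor linears \<Phi>_tensor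
    \<alpha>_mult \<gamma>_mult assoc)

lemma \<Phi>_twisted_mult: "\<Phi> (twisted_mult \<mu>C \<mu>A \<xi> (s \<otimes> t)) = \<Phi> s \<odot> \<Phi> t"
proof -
  have lin: "vlinear (twisted_mult \<mu>C \<mu>A \<xi>)"
    unfolding twisted_mult_def by (intro vlinear_comp linears)
  have pure: "\<Phi> (twisted_mult \<mu>C \<mu>A \<xi> ((a \<otimes> c) \<otimes> (a' \<otimes> c'))) = \<Phi> (a \<otimes> c) \<odot> \<Phi> (a' \<otimes> c')"
    for a c a' c'
    by (simp add: twisted_mult_def tassoc_tensor tassoc_inv_tensor tensor_map_tensor linears
        \<Phi>_mult_both \<Phi>_\<xi> \<Phi>_tensor assoc)
  have left: "Vector_Spaces.linear (*s) scale (\<lambda>s. \<Phi> (twisted_mult \<mu>C \<mu>A \<xi> (s \<otimes> t)))" for t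
    by (rule vlinear_tensor_left[THEN linear_fun_comp, OF lin,
        THEN linear_fun_comp, OF linear_\<Phi>])
  have right: "Vector_Spaces.linear (*s) scale (\<lambda>t. \<Phi> (twisted_mult \<mu>C \<mu>A \<xi> (s \<otimes> t)))" for s
    by (rule vlinear_tensor_right[THEN linear_fun_comp, OF lin,
        THEN linear_fun_comp, OF linear_\<Phi>])
  have "\<Phi> (twisted_mult \<mu>C \<mu>A \<xi> ((a \<otimes> c) \<otimes> t)) = \<Phi> (a \<otimes> c) \<odot> \<Phi> t" for a c
    by (rule linear_eq_on_tensors[OF right
          linear_\<Phi>[THEN linear_fun_comp, OF linear_right], where t = t]) (rule pure)
  then show ?thesis
    by (rule linear_eq_on_tensors[OF left
          linear_\<Phi>[THEN linear_fun_comp, OF linear_left], where t = s])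
qed

lemma isomorphic_twisted:
  "algebra_isomorphic (*s) (\<lambda>x y. twisted_mult \<mu>C \<mu>A \<xi> (x \<otimes> y)) (uA \<otimes> uC) scale (\<odot>) unit"
  unfolding algebra_isomorphic_def
  by (intro exI[of _ \<Phi>])
    (simp add: linear_\<Phi> bij_\<Phi> \<Phi>_twisted_mult \<Phi>_tensor \<alpha>_unit \<gamma>_unit unit_left)

end

section \<open>The inverse matrix in terms of cross products\<close>

lemma bij_betw_idx_pos: "bij_betw idx_pos (UNIV :: 'n::{finite,linorder} set) {..<CARD('n)}"
proof -
  have mono: "idx_pos i < idx_pos j" if "i < j" for i j :: 'n
    unfolding idx_pos_def by (rule psubset_card_mono) (use that in auto)
  hence inj: "inj (idx_pos :: 'n \<Rightarrow> nat)"
    by (metis (no_types, lifting) injI nat_neq_iff neq_iff)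
  have "idx_pos i < CARD('n)" for i :: 'n
    unfolding idx_pos_def by (rule psubset_card_mono) auto
  hence "range (idx_pos :: 'n \<Rightarrow> nat) = {..<CARD('n)}"
    by (intro card_subset_eq) (auto simp: card_image inj)
  with inj show ?thesis by (simp add: bij_betw_def)
qed

lemma det_matrix_of_rows_swap:
  fixes ps qs :: "('a::field^'n::{finite,linorder}) list"
  assumes "length ps + 2 + length qs = CARD('n)"
  shows "det (matrix_of_rows (ps @ x # y # qs) :: 'a^'n::_^'n::_) =
    - det (matrix_of_rows (ps @ y # x # qs) :: 'a^'n::_^'n::_)"
proof -
  have pos: "\<exists>r :: 'n. idx_pos r = m" if "m < CARD('n)" for m
    using that bij_betw_idx_pos by (metis bij_betw_imp_surj_on imageE lessThan_iff)
  obtain r s :: 'n where rs: "idx_pos r = length ps" "idx_pos s = Suc (length ps)"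
    using pos[of "length ps"] pos[of "Suc (length ps)"] assms by auto
  have inj: "idx_pos i = idx_pos j \<longleftrightarrow> i = j" for i j :: 'n
    using bij_betw_idx_pos[where 'n = 'n] by (auto simp: bij_betw_def inj_eq)
  let ?\<tau> = "Transposition.transpose r s"
  let ?M = "matrix_of_rows (ps @ y # x # qs) :: 'a^'n::_^'n::_"
  have "(ps @ x # y # qs) ! idx_pos k = (ps @ y # x # qs) ! idx_pos (?\<tau> k)" for k
  proof (cases "k = r \<or> k = s")
    case True
    then show ?thesis using rs by (auto simp: nth_append)
  next
    case False
    hence "idx_pos k \<noteq> length ps" "idx_pos k \<noteq> Suc (length ps)" by (metis inj rs)+
    then show ?thesis using False
      by (auto simp: nth_append nth_Cons' transpose_def)
  qed
  hence "matrix_of_rows (ps @ x # y # qs) = (\<chi> k. ?M $ ?\<tau> k)"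
    by (simp add: matrix_of_rows_def vec_eq_iff)
  moreover have "r \<noteq> s" using rs by auto
  ultimately show ?thesis
    using det_permute_rows[of ?\<tau> ?M] by (simp add: permutes_swap_id sign_swap_id)
qed

text \<open>
  Moving a row by adjacent swaps makes the sign of the cyclic permutation of the rows come out as one
  factor \<open>-1\<close> per step.
\<close>

lemma det_matrix_of_rows_move:
  fixes ps qs :: "('a::field^'n::{finite,linorder}) list"
  assumes "length ps + 1 + length qs = CARD('n)"
  shows "det (matrix_of_rows (ps @ x # qs) :: 'a^'n::_^'n::_) =
    (- 1) ^ length ps * det (matrix_of_rows (x # ps @ qs) :: 'a^'n::_^'n::_)"
  using assms
proof (induction ps arbitrary: qs rule: rev_induct)
  case (snoc y ps)
  have "det (matrix_of_rows (ps @ y # x # qs) :: 'a^'n::_^'n::_) =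
      - det (matrix_of_rows (ps @ x # y # qs) :: 'a^'n::_^'n::_)"
    by (rule det_matrix_of_rows_swap) (use snoc.prems in simp)
  with snoc.IH[of "y # qs"] snoc.prems show ?case by simp
qed simp

lemma sorted_list_of_UNIV_split:
  fixes i :: "'n::{finite,linorder}"
  obtains ps qs where "sorted_list_of_set UNIV = ps @ i # qs"
    "length ps = idx_pos i" "i \<notin> set ps" "i \<notin> set qs"
proof -
  let ?L = "sorted_list_of_set (UNIV :: 'n set)"
  have "i \<in> set ?L" by simp
  then obtain ps qs where split: "?L = ps @ i # qs" by (meson split_list)
  have sorted: "sorted_wrt (<) (ps @ i # qs)" and dist: "distinct (ps @ i # qs)"
    by (metis split strict_sorted_list_of_set, metis split distinct_sorted_list_of_set)
  have "set (ps @ i # qs) = UNIV"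
    by (metis split set_sorted_list_of_set finite)
  hence "x \<in> set ps \<or> x = i \<or> x \<in> set qs" for x by auto
  moreover have "x < i" if "x \<in> set ps" for x using sorted that by (simp add: sorted_wrt_append)
  moreover have "i < x" if "x \<in> set qs" for x using sorted that by (simp add: sorted_wrt_append)
  ultimately have "set ps = {..<i}" by (force simp: set_eq_iff)
  hence "length ps = idx_pos i"
    using dist by (metis distinct_append distinct_card idx_pos_def)
  with that split dist show thesis by simp
qed

lemma matrix_of_rows_sorted:
  fixes w :: "'n::{finite,linorder} \<Rightarrow> 'a::field^'n::_"
  shows "matrix_of_rows (map w (sorted_list_of_set UNIV)) = (\<chi> k. w k)"
proof -
  have "map w (sorted_list_of_set UNIV) ! idx_pos k = w k" for k
    by (rule sorted_list_of_UNIV_split[of k]) (simp add: nth_append flip: map_append)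
  thus ?thesis by (simp add: matrix_of_rows_def vec_eq_iff)
qed

text \<open>
  The cross product pairs with \<open>x\<close> by placing \<open>x\<close> on top of the remaining rows; the sign restores
  \<open>x\<close> to the row left free by the omission.
\<close>

lemma scalar_product_cross_omit:
  fixes v :: "'n::{finite,linorder} \<Rightarrow> 'a::field^'n::_"
  shows "(- 1) ^ idx_pos i * scalar_product (cross_omit v i) x = det (\<chi> k. (v(i := x)) k)"
proof -
  obtain ps qs where L: "sorted_list_of_set UNIV = ps @ i # qs"
    and len: "length ps = idx_pos i" and notin: "i \<notin> set ps" "i \<notin> set qs"
    by (rule sorted_list_of_UNIV_split)
  have omit: "filter (\<lambda>j. j \<noteq> i) (sorted_list_of_set UNIV) = ps @ qs"
    using notin filter_id_conv[of "\<lambda>j. j \<noteq> i" ps] filter_id_conv[of "\<lambda>j. j \<noteq> i" qs]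
    by (auto simp: L)
  have rows: "map (v(i := x)) (sorted_list_of_set UNIV) = map v ps @ x # map v qs"
    using notin by (auto simp: L)
  have "length (sorted_list_of_set (UNIV :: 'n set)) = CARD('n)" by simp
  hence card: "length ps + 1 + length qs = CARD('n)" by (simp add: L)
  have "scalar_product (cross_omit v i) x = det (matrix_of_rows (x # map v (ps @ qs)))"
    using theI'[OF cross_product_ex1[of "map v (ps @ qs)"]]
    unfolding cross_omit_def omit cross_product_def by blast
  moreover have "det (matrix_of_rows (map v ps @ x # map v qs) :: 'a^'n::_^'n::_) =
      (- 1) ^ idx_pos i * det (matrix_of_rows (x # map v ps @ map v qs) :: 'a^'n::_^'n::_)"
    using det_matrix_of_rows_move[of "map v ps" "map v qs" x] card len by simp
  ultimately show ?thesis
    using matrix_of_rows_sorted[of "v(i := x)"] rows by simp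
qed

text \<open>
  With \<open>x = v j\<close> the determinant of the previous lemma is the given one if \<open>j = i\<close>, and otherwise it has
  \<open>v j\<close> in both row \<open>i\<close> and row \<open>j\<close>.
\<close>

lemma cross_omit_inverse:
  fixes v :: "'n::{finite,linorder} \<Rightarrow> 'a::field^'n::_"
  assumes "det (\<chi> k i. v i $ k) = 1"
  shows "(\<chi> i. (- 1) ^ idx_pos i *s cross_omit v i) ** (\<chi> k i. v i $ k) = mat 1"
proof -
  have det: "det (\<chi> k. v k) = 1"
    using det_transpose[of "\<chi> k. v k"] assms by (simp add: Finite_Cartesian_Product.transpose_def)
  have "(- 1) ^ idx_pos i * scalar_product (cross_omit v i) (v j) = (if i = j then 1 else 0)" for i j
  proof (cases "i = j")
    case True
    then show ?thesis unfolding scalar_product_cross_omit by (simp add: det)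
  next
    case False
    then show ?thesis unfolding scalar_product_cross_omit
      by (auto intro!: det_identical_rows[of i j] simp: row_def vec_eq_iff)
  qed
  thus ?thesis
    by (simp add: matrix_matrix_mult_def mat_def vec_eq_iff scalar_product_def sum_distrib_left
        mult.assoc)
qed

section \<open>Diagonal matrices and the matrix algebra\<close>

definition diag :: "'a::field^'n \<Rightarrow> 'a^'n^'n" where
  "diag a = (\<chi> i j. if i = j then a $ i else 0)"

lemma diag_mult_nth: "(diag a ** M) $ i $ j = a $ i * M $ i $ j"
  by (simp add: diag_def matrix_matrix_mult_def if_distrib[of "\<lambda>x. x * _"] cong: if_cong)

lemma mult_diag_nth: "(M ** diag a) $ i $ j = M $ i $ j * a $ j"
  by (simp add: diag_def matrix_matrix_mult_def if_distrib[of "\<lambda>x. _ * x"] cong: if_cong)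

lemma diag_mult: "diag (a * b) = diag a ** diag b"
  by (simp add: vec_eq_iff diag_mult_nth) (simp add: diag_def)

lemma diag_one: "diag 1 = mat 1"
  by (simp add: diag_def mat_def vec_eq_iff)

lemma linear_matrix_mult_left:
  "Vector_Spaces.linear mat_scale mat_scale (\<lambda>M. M ** (N :: 'a::field^'n^'n))"
  by unfold_locales
    (simp_all add: mat_scale_def matrix_matrix_mult_def vec_eq_iff sum.distrib sum_distrib_left
      algebra_simps)

lemma linear_matrix_mult_right:
  "Vector_Spaces.linear mat_scale mat_scale (\<lambda>M. (N :: 'a::field^'n^'n) ** M)"
  by unfold_locales
    (simp_all add: mat_scale_def matrix_matrix_mult_def vec_eq_iff sum.distrib sum_distrib_left
      algebra_simps)

section \<open>Twist matrices\<close>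

lemma vlinear_twist_matrix:
  fixes \<xi> :: "'a::field^('m::finite \<times> 'n::finite) \<Rightarrow> 'a^('n \<times> 'm)"
  assumes "vlinear \<xi>"
  shows "\<xi> t $ (k, l) = (\<Sum>i\<in>UNIV. \<Sum>j\<in>UNIV. t $ (i, j) * twist_matrix \<xi> i l $ k $ j)"
proof -
  interpret Vector_Spaces.linear "(*s)" "(*s)" \<xi> by (rule assms)
  have "\<xi> t = \<xi> (\<Sum>p\<in>UNIV. t $ p *s axis p 1)" by (simp only: basis_expansion)
  also have "\<dots> $ (k, l) = (\<Sum>p\<in>UNIV \<times> UNIV. t $ p * \<xi> (axis p 1) $ (k, l))"
    by (simp add: sum scale)
  also have "\<dots> = (\<Sum>i\<in>UNIV. \<Sum>j\<in>UNIV. t $ (i, j) * \<xi> (axis (i, j) 1) $ (k, l))"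
    by (subst sum.cartesian_product) (auto intro: sum.cong)
  finally show ?thesis by (simp add: twist_matrix_def axis_tensor_axis)
qed

text \<open>
  A linear map has arbitrary coefficients in the bases of pure tensors. This settles existence and
  uniqueness at once, so that only the twisting axioms remain for the map with given coefficients.
\<close>

lemma ex1_vlinear_twist_matrix:
  fixes A :: "'m::finite \<Rightarrow> 'm \<Rightarrow> 'a::field^'n^'n::finite"
  shows "\<exists>!\<xi>. vlinear \<xi> \<and> (\<forall>i l. twist_matrix \<xi> i l = A i l)"
proof (rule ex1I)
  let ?\<xi> = "\<lambda>t. \<chi> p. \<Sum>i\<in>UNIV. \<Sum>j\<in>UNIV. t $ (i, j) * A i (snd p) $ fst p $ j"
  have "(\<Sum>i\<in>UNIV. \<Sum>j\<in>UNIV. axis (i', j') 1 $ (i, j) * A i l $ k $ j) = A i' l $ k $ j'"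
    for i' j' l k
  proof -
    have "(\<Sum>i\<in>UNIV. \<Sum>j\<in>UNIV. axis (i', j') 1 $ (i, j) * A i l $ k $ j) =
        (\<Sum>i\<in>UNIV. if i = i' then \<Sum>j\<in>UNIV. if j = j' then A i l $ k $ j else 0 else 0)"
      by (intro sum.cong refl) (auto simp: axis_def if_distrib[of "\<lambda>x. x * _"] cong: if_cong)
    thus ?thesis by simp
  qed
  moreover have "vlinear ?\<xi>"
    by unfold_locales (simp_all add: vec_eq_iff sum.distrib sum_distrib_left algebra_simps)
  ultimately show "vlinear ?\<xi> \<and> (\<forall>i l. twist_matrix ?\<xi> i l = A i l)"
    by (simp add: twist_matrix_def axis_tensor_axis vec_eq_iff)
next
  fix \<xi> assume "vlinear \<xi> \<and> (\<forall>i l. twist_matrix \<xi> i l = A i l)"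
  then show "\<xi> = (\<lambda>t. \<chi> p. \<Sum>i\<in>UNIV. \<Sum>j\<in>UNIV. t $ (i, j) * A i (snd p) $ fst p $ j)"
    by (auto simp: fun_eq_iff vec_eq_iff vlinear_twist_matrix)
qed

section \<open>Factoring the matrix algebra into two diagonal subalgebras\<close>

text \<open>
  Diagonal matrices and diagonal matrices in the basis of columns of \<open>V\<close> together factor the matrix
  algebra. The formula for \<open>\<Phi>\<close> is \<open>diag a ** V ** diag c ** U\<close> with \<open>a\<^sub>k c\<^sub>l\<close> replaced by
  \<open>t\<^bsub>kl\<^esub>\<close>, which extends that product to all tensors.
\<close>

lemma matrix_algebra_factorization:
  fixes V U :: "'a::field^'n^'n" and \<xi> :: "'a^('n \<times> 'n) \<Rightarrow> 'a^('n \<times> 'n)"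
  assumes nz: "\<And>k l. V $ k $ l \<noteq> 0"
    and UV: "U ** V = mat 1"
    and lin: "vlinear \<xi>"
    and twist: "\<And>i l k j. twist_matrix \<xi> i l $ k $ j =
      inverse (V $ k $ l) * V $ k $ i * (V $ j $ l * U $ i $ j)"
  shows "algebra_factorization mat_scale (**) (mat 1) entry_mult 1 entry_mult 1
    diag (\<lambda>c. V ** diag c ** U) (\<lambda>t. (\<chi> k l. t $ (k, l) * V $ k $ l) ** U) \<xi>"
proof -
  let ?\<gamma> = "\<lambda>c. V ** diag c ** U"
  let ?H = "\<lambda>t :: 'a^('n \<times> 'n). (\<chi> k l. t $ (k, l) * V $ k $ l) :: 'a^'n^'n"
  let ?\<Phi> = "\<lambda>t. ?H t ** U"
  have VU: "V ** U = mat 1" using UV by (simp add: matrix_left_right_inverse)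
  have cancel: "M ** U ** V = M" "M ** V ** U = M" for M :: "'a^'n^'n"
    by (simp_all add: UV VU flip: matrix_mul_assoc)
  have linear_\<Phi>: "Vector_Spaces.linear (*s) mat_scale ?\<Phi>"
    by unfold_locales
      (simp_all add: mat_scale_def matrix_matrix_mult_def vec_eq_iff sum.distrib sum_distrib_left
        algebra_simps)
  \<comment> \<open>The inverse undoes \<open>U\<close> by \<open>V\<close> and then divides entrywise by \<open>V\<close>.\<close>
  have bij: "bij ?\<Phi>"
    by (rule bij_betw_byWitness[where f' = "\<lambda>M. \<chi> p. (M ** V) $ fst p $ snd p / V $ fst p $ snd p"])
      (simp_all add: cancel nz vec_eq_iff)
  have tensor: "?\<Phi> (a \<otimes> c) = diag a ** ?\<gamma> c" for a c
  proof -
    have "?H (a \<otimes> c) = diag a ** (V ** diag c)"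
      by (simp add: vec_eq_iff diag_mult_nth mult_diag_nth tensor_def mult.commute mult.left_commute)
    thus ?thesis by (simp add: matrix_mul_assoc)
  qed
  \<comment> \<open>After multiplication by \<open>V\<close> from the right, both sides are the same double sum.\<close>
  have swap: "?\<Phi> (\<xi> (c \<otimes> a)) = ?\<gamma> c ** diag a" for a c
  proof -
    have "\<xi> (c \<otimes> a) $ (k, l) * V $ k $ l = (?\<gamma> c ** diag a ** V) $ k $ l" for k l
    proof -
      have "\<xi> (c \<otimes> a) $ (k, l) * V $ k $ l =
          (\<Sum>i\<in>UNIV. \<Sum>j\<in>UNIV. V $ k $ i * c $ i * U $ i $ j * a $ j * V $ j $ l)"
        unfolding vlinear_twist_matrix[OF lin] twist sum_distrib_right
        by (intro sum.cong refl) (simp add: tensor_def nz field_simps)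
      also have "\<dots> = (\<Sum>j\<in>UNIV. (?\<gamma> c ** diag a) $ k $ j * V $ j $ l)"
        by (subst sum.swap)
          (simp add: mult_diag_nth matrix_matrix_mult_def[of _ U] sum_distrib_right)
      finally show ?thesis by (simp add: matrix_matrix_mult_def[of _ V])
    qed
    hence "?H (\<xi> (c \<otimes> a)) = ?\<gamma> c ** diag a ** V" by (simp add: vec_eq_iff)
    thus ?thesis by (simp add: cancel)
  qed
  have \<gamma>_mult: "?\<gamma> (c * c') = ?\<gamma> c ** ?\<gamma> c'" for c c'
    by (simp add: diag_mult matrix_mul_assoc cancel)
  show ?thesis
    by (rule algebra_factorization.intro)
      (simp_all add: matrix_mul_assoc linear_matrix_mult_left linear_matrix_mult_right
        unital_algebra_entry_mult entry_mult_tensor diag_mult diag_one VU \<gamma>_mult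
        linear_\<Phi> bij tensor lin swap cancel
        del: vec_lambda_beta)
qed

theorem theorem4p17:
  fixes v :: "'n::{finite,linorder} \<Rightarrow> 'a::field^'n::_"
  assumes invertible: "\<And>i k. v i $ k \<noteq> 0"
    and first: "v (Min UNIV) = 1"
    and det_one: "det (\<chi> k i. v i $ k) = 1"
  shows
    "(\<exists>!\<xi> :: 'a^('n \<times> 'n) \<Rightarrow> 'a^('n \<times> 'n).
        twisting_map entry_mult 1 entry_mult 1 \<xi> \<and>
        (\<forall>i l. twist_matrix \<xi> i l =
          mat_scale ((- 1) ^ idx_pos i)
            (columnvector (bullet_inv (v l) * v i) **
             (rowvector (v l * cross_omit v i) :: ('a^'n::_)^1)))) \<and>
     (\<forall>\<xi> :: 'a^('n \<times> 'n) \<Rightarrow> 'a^('n \<times> 'n).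
        twisting_map entry_mult 1 entry_mult 1 \<xi> \<longrightarrow>
        (\<forall>i l. twist_matrix \<xi> i l =
          mat_scale ((- 1) ^ idx_pos i)
            (columnvector (bullet_inv (v l) * v i) **
             (rowvector (v l * cross_omit v i) :: ('a^'n::_)^1))) \<longrightarrow>
        algebra_isomorphic
          (*s) (\<lambda>x y. twisted_mult entry_mult entry_mult \<xi> (x \<otimes> y)) (1 \<otimes> 1)
          mat_scale (**) (mat 1 :: ('a^'n::_)^'n::_))"
proof -
  define A :: "'n \<Rightarrow> 'n \<Rightarrow> 'a^'n::_^'n::_" where
    "A i l = mat_scale ((- 1) ^ idx_pos i)
      (columnvector (bullet_inv (v l) * v i) ** (rowvector (v l * cross_omit v i) :: ('a^'n::_)^1))"
    for i l
  have factorization: "\<exists>\<Phi> \<alpha> \<gamma>. algebra_factorization mat_scale (**) (mat 1 :: 'a^'n::_^'n::_)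
      entry_mult 1 entry_mult 1 \<alpha> \<gamma> \<Phi> \<xi>"
    if "vlinear \<xi>" "\<forall>i l. twist_matrix \<xi> i l = A i l" for \<xi>
    by (intro exI, rule matrix_algebra_factorization[OF _ cross_omit_inverse[OF det_one] that(1)])
      (use that(2) in \<open>simp_all add: invertible A_def mat_scale_def matrix_matrix_mult_def
        columnvector_def rowvector_def bullet_inv_def\<close>)
  have twisting: "twisting_map entry_mult 1 entry_mult 1 \<xi> \<longleftrightarrow> vlinear \<xi>"
    if twist: "\<forall>i l. twist_matrix \<xi> i l = A i l" for \<xi>
  proof
    assume "vlinear \<xi>"
    then obtain \<Phi> \<alpha> \<gamma> where "algebra_factorization mat_scale (**) (mat 1 :: 'a^'n::_^'n::_)
        entry_mult 1 entry_mult 1 \<alpha> \<gamma> \<Phi> \<xi>"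
      using factorization[OF _ twist] by blast
    then show "twisting_map entry_mult 1 entry_mult 1 \<xi>" by (rule algebra_factorization.twisting_map)
  qed (simp add: twisting_map_def)
  have "\<exists>!\<xi>. twisting_map entry_mult 1 entry_mult 1 \<xi> \<and> (\<forall>i l. twist_matrix \<xi> i l = A i l)"
    using ex1_vlinear_twist_matrix[of A] twisting by metis
  moreover have "algebra_isomorphic (*s) (\<lambda>x y. twisted_mult entry_mult entry_mult \<xi> (x \<otimes> y)) (1 \<otimes> 1)
      mat_scale (**) (mat 1 :: 'a^'n::_^'n::_)"
    if "twisting_map entry_mult 1 entry_mult 1 \<xi>" "\<forall>i l. twist_matrix \<xi> i l = A i l" for \<xi>
    using factorization[OF _ that(2)] twisting[OF that(2)] that(1)
      algebra_factorization.isomorphic_twisted by blast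
  ultimately show ?thesis unfolding A_def by blast
qed

end
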